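(* Let $\mathbb{F}_q$ be a finite field of odd characteristic with $q\equiv 1\pmod 6$, let $T$ be a generator of the group of multiplicative characters of $\mathbb{F}_q$, and let $a,b,c\in\mathbb{F}_q^\times$ be all distinct. If $h\in\mathbb{F}_q^\times$ satisfies $3h^2+2(a+b+c)h+ab+bc+ca=0$, then $$\psi_{(1,1,1)}(a,b,c)=q\,\varphi(-3d)\;{_2}F_1\left(\begin{array}{cc}T^{\frac{q-1}{6}},&T^{\frac{5(q-1)}{6}}\\ &\varepsilon\end{array}\Big|\ -\frac{3^3e}{2^2d^3}\right),$$ where $d=3h+a+b+c$ and $e=h^3+(a+b+c)h^2+(ab+bc+ca)h+abc$.
   Context: Multiplicative characters $\chi:\mathbb{F}_q^\times\to\mathbb{C}^\times$ are extended to $\mathbb{F}_q$ by $\chi(0):=0$, including the trivial character $\varepsilon$; $\overline{\chi}$ is the inverse of $\chi$. $\varphi$ is the quadratic character and $\varepsilon$ the trivial character of $\mathbb{F}_q$. $\psi_{(1,1,1)}(a,b,c):=\sum_{x\in\mathbb{F}_q}\varphi(x+a)\varphi(x+b)\varphi(x+c)$. For characters $A,B,C$ and $x\in\mathbb{F}_q$, Greene's finite field hypergeometric series is $${_2}F_1\left(\begin{array}{cc}A,&B\\ &C\end{array}\Big|\ x\right):=\varepsilon(x)\frac{BC(-1)}{q}\sum_{y\in\mathbb{F}_q}B(y)\,\overline{B}C(1-y)\,\overline{A}(1-xy).$$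
   Formalization: The formal theorem additionally assumes d = 3h+a+b+c is nonzero; when d = 0 (which can occur, e.g. q = 7, a,b,c = 2,3,5, h = -1) the argument -27e/(4d^3) is undefined. *)

theory Defs
  imports
    Complex_Main
    "HOL-Library.Cardinality"
    "HOL-Computational_Algebra.Primes"
    "HOL-Number_Theory.Cong"
    "HOL-Algebra.Generated_Groups"
begin

text \<open>
  A multiplicative character is represented by its extension by zero to the whole field. The
  neutral element is therefore the function with value \<open>0\<close> at \<open>0\<close> and \<open>1\<close> elsewhere, not the
  constant function \<open>1\<close>.
\<close>

definition mult_characters :: "('a::finite_field \<Rightarrow> complex) set" where
  "mult_characters = {\<chi>. \<chi> 0 = 0 \<and> (\<forall>x. x \<noteq> 0 \<longrightarrow> \<chi> x \<noteq> 0) \<and>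
     (\<forall>x y. x \<noteq> 0 \<longrightarrow> y \<noteq> 0 \<longrightarrow> \<chi> (x * y) = \<chi> x * \<chi> y)}"

definition trivial_char :: "'a::finite_field \<Rightarrow> complex" where
  "trivial_char x = (if x = 0 then 0 else 1)"

definition quadratic_char :: "'a::finite_field \<Rightarrow> complex" where
  "quadratic_char x = (if x = 0 then 0 else if \<exists>y. x = y ^ 2 then 1 else -1)"

definition char_group :: "('a::finite_field \<Rightarrow> complex) monoid" where
  "char_group = \<lparr>carrier = mult_characters, mult = (\<lambda>A B x. A x * B x), one = trivial_char\<rparr>"

lemma inverse_in_mult_characters:
  assumes "A \<in> mult_characters"
  shows "(\<lambda>x. inverse (A x)) \<in> mult_characters"
  using assms unfolding mult_characters_def by auto

lemma comm_group_char_group: "comm_group (char_group :: ('a::finite_field \<Rightarrow> complex) monoid)"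
proof (rule comm_groupI)
  fix A :: "'a \<Rightarrow> complex"
  assume A: "A \<in> carrier char_group"
  have "(\<lambda>x. inverse (A x)) \<in> carrier char_group"
    using A inverse_in_mult_characters[of A] by (simp add: char_group_def)
  moreover have "(\<lambda>x. inverse (A x)) \<otimes>\<^bsub>char_group\<^esub> A = \<one>\<^bsub>char_group\<^esub>"
    using A by (auto simp: char_group_def mult_characters_def trivial_char_def)
  ultimately show "\<exists>B\<in>carrier char_group. B \<otimes>\<^bsub>char_group\<^esub> A = \<one>\<^bsub>char_group\<^esub>" by blast
qed (auto simp: char_group_def mult_characters_def trivial_char_def mult_ac fun_eq_iff)

text \<open>Since \<open>inverse 0 = 0\<close>, the group inverse is the pointwise inverse also at \<open>0\<close>.\<close>

lemma inv_char_group: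
  fixes A :: "'a::finite_field \<Rightarrow> complex"
  assumes "A \<in> mult_characters"
  shows "inv\<^bsub>char_group\<^esub> A = (\<lambda>x. inverse (A x))"
proof -
  interpret comm_group "char_group :: ('a \<Rightarrow> complex) monoid" by (rule comm_group_char_group)
  show ?thesis
  proof (rule inv_equality)
    show "(\<lambda>x. inverse (A x)) \<otimes>\<^bsub>char_group\<^esub> A = \<one>\<^bsub>char_group\<^esub>"
      using assms by (auto simp: char_group_def mult_characters_def trivial_char_def)
  qed (use assms inverse_in_mult_characters[of A] in \<open>auto simp: char_group_def\<close>)
qed

definition psi_111 :: "'a::finite_field \<Rightarrow> 'a \<Rightarrow> 'a \<Rightarrow> complex" where
  "psi_111 a b c = (\<Sum>x\<in>UNIV. quadratic_char (x + a) * quadratic_char (x + b) * quadratic_char (x + c))"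

text \<open>Greene's series \<open>2F1(A, B; C | x)\<close>, with \<open>q = CARD('a)\<close>.\<close>

definition greene_2F1 ::
    "('a::finite_field \<Rightarrow> complex) \<Rightarrow> ('a \<Rightarrow> complex) \<Rightarrow> ('a \<Rightarrow> complex) \<Rightarrow> 'a \<Rightarrow> complex" where
  "greene_2F1 A B C x =
     trivial_char x * ((B \<otimes>\<^bsub>char_group\<^esub> C) (-1) / of_nat CARD('a)) *
     (\<Sum>y\<in>UNIV. B y * ((inv\<^bsub>char_group\<^esub> B) \<otimes>\<^bsub>char_group\<^esub> C) (1 - y) *
        (inv\<^bsub>char_group\<^esub> A) (1 - x * y))"

end

theory Submission
  imports Defs "HOL-Algebra.Multiplicative_Group"
begin

text \<open>
  Put \<open>z = -27 e / (4 d\<^sup>3)\<close>, let \<open>\<phi>\<close> be the quadratic character and \<open>B = T\<^bsup>5(q-1)/6\<^esup>\<close>, so that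
  \<open>B\<^sup>3 = \<phi>\<close> and \<open>\<eta> = B\<^sup>4\<close> is a cubic character. The substitution \<open>x = h + d (s - 1) / 3\<close> turns
  \<open>\<psi>\<close> into \<open>\<phi>(3d) \<Sum>\<^sub>s \<phi>(s\<^sup>3 - 3 s + 2 - 4 z)\<close>. Collecting the terms of the hypergeometric sum by
  the value \<open>v = y (1 - z y) / (1 - y)\<close>, a quadratic equation for \<open>y\<close>, turns it into
  \<open>\<Sum>\<^sub>v \<eta>(v) \<phi>(v + v\<^sup>-\<^sup>1 + 2 - 4 z)\<close>. The two agree by Cardano's formula:
  \<open>s = w + w\<^sup>-\<^sup>1\<close> gives \<open>s\<^sup>3 - 3 s = w\<^sup>3 + w\<^sup>-\<^sup>3\<close>, hence
  \<open>\<Sum>\<^sub>s f(s\<^sup>3 - 3 s) = \<Sum>\<^sub>r f(r) + \<Sum>\<^sub>v \<eta>(v) f(v + v\<^sup>-\<^sup>1)\<close> for every function \<open>f\<close>.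
\<close>

section \<open>Primitive elements of finite fields\<close>

text \<open>Bridge from the type class to the carrier-based fields of \<open>HOL-Algebra\<close>,
  for which cyclicity of the multiplicative group is available.\<close>

definition field_ring :: "'a::field ring" where
  "field_ring = \<lparr>carrier = UNIV, monoid.mult = (*), one = 1, zero = 0, add = (+)\<rparr>"

lemma field_field_ring: "field (field_ring :: 'a::field ring)"
proof (rule cring.cring_fieldI2)
  have ab: "abelian_group (field_ring :: 'a ring)"
  proof (rule abelian_groupI)
    fix x :: 'a
    have "- x + x = 0" by simp
    then show "\<exists>y\<in>carrier field_ring. y \<oplus>\<^bsub>field_ring\<^esub> x = \<zero>\<^bsub>field_ring\<^esub>"
      by (intro bexI[of _ "- x"]) (simp_all add: field_ring_def)
  qed (simp_all add: field_ring_def algebra_simps)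
  have cm: "Group.comm_monoid (field_ring :: 'a ring)"
    by (rule comm_monoidI) (simp_all add: field_ring_def algebra_simps)
  show "cring (field_ring :: 'a ring)"
    by (rule cringI[OF ab cm]) (simp add: field_ring_def algebra_simps)
  show "\<zero>\<^bsub>field_ring\<^esub> \<noteq> (\<one>\<^bsub>field_ring\<^esub> :: 'a)"
    by (simp add: field_ring_def)
  fix x :: 'a
  assume "x \<noteq> \<zero>\<^bsub>field_ring\<^esub>"
  then have "x * inverse x = 1" by (simp add: field_ring_def)
  then show "\<exists>y\<in>carrier field_ring. x \<otimes>\<^bsub>field_ring\<^esub> y = \<one>\<^bsub>field_ring\<^esub>"
    by (intro bexI[of _ "inverse x"]) (simp_all add: field_ring_def)
qed

lemma field_ring_pow: "x [^]\<^bsub>field_ring\<^esub> (n::nat) = x ^ n"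
  by (induction n) (simp_all add: field_ring_def nat_pow_def mult.commute)

lemma finite_field_power_card_minus_1:
  fixes x :: "'a::finite_field"
  assumes "x \<noteq> 0"
  shows "x ^ (CARD('a) - 1) = 1"
proof -
  have "x ^ (CARD('a) - 1) * x = 1 * x"
    using finite_field_power_card_eq_same[of x] by (simp flip: power_Suc2)
  then show ?thesis using assms by simp
qed

text \<open>The unit group is cyclic. The last conjunct says that the generator has order exactly q
  - 1, in the form of a divisibility of exponents that later order arguments use.\<close>

lemma finite_field_primitive_element:
  "\<exists>g :: 'a::finite_field. g \<noteq> 0 \<and> (\<forall>x. x \<noteq> 0 \<longrightarrow> (\<exists>k. x = g ^ k)) \<and>
     (\<forall>j. g ^ j = 1 \<longleftrightarrow> CARD('a) - 1 dvd j)"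
proof -
  interpret F: field "field_ring :: 'a ring" by (rule field_field_ring)
  obtain g where g: "g \<in> carrier (mult_of (field_ring :: 'a ring))"
    and gen: "carrier (mult_of (field_ring :: 'a ring)) = {g [^]\<^bsub>field_ring\<^esub> i | i::nat. i \<in> UNIV}"
    using F.finite_field_mult_group_has_gen by auto
  have g0: "g \<noteq> 0" using g by (simp add: mult_of_def field_ring_def)
  have pow: "\<exists>k. x = g ^ k" if "x \<noteq> 0" for x
  proof -
    have "x \<in> carrier (mult_of (field_ring :: 'a ring))"
      using that by (simp add: mult_of_def field_ring_def)
    then show ?thesis unfolding gen field_ring_pow by auto
  qed
  define n where "n = CARD('a) - 1"
  have n0: "n > 0"
    using card_mono[of UNIV "{0, 1 :: 'a}"] by (simp add: n_def)
  have gn: "g ^ n = 1"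
    using finite_field_power_card_minus_1[OF g0] by (simp add: n_def)
  have dvd: "n dvd j" if "g ^ j = 1" for j
  proof (rule ccontr)
    assume "\<not> n dvd j"
    define r where "r = j mod n"
    have r: "0 < r" "r < n" using \<open>\<not> n dvd j\<close> n0 by (auto simp: r_def mod_greater_zero_iff_not_dvd)
    have "g ^ j = g ^ (n * (j div n) + r)" by (simp add: r_def)
    then have "g ^ r = 1" using that gn by (simp add: power_add power_mult)
    \<comment> \<open>Powers of \<open>g\<close> would repeat with period \<open>r\<close>, giving
      at most \<open>r\<close> nonzero elements where there are \<open>n\<close>.\<close>
    have "UNIV - {0} \<subseteq> (\<lambda>k. g ^ k) ` {..<r}"
    proof
      fix x :: 'a assume "x \<in> UNIV - {0}"
      then obtain k where "x = g ^ k" using pow by auto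
      also have "\<dots> = g ^ (r * (k div r) + k mod r)" by simp
      also have "\<dots> = g ^ (k mod r)" unfolding power_add power_mult \<open>g ^ r = 1\<close> by simp
      finally show "x \<in> (\<lambda>k. g ^ k) ` {..<r}" using r(1) by auto
    qed
    then have "card (UNIV - {0 :: 'a}) \<le> r"
      by (metis surj_card_le card_lessThan finite_lessThan)
    then show False using r by (simp add: n_def)
  qed
  have "g ^ j = 1 \<longleftrightarrow> CARD('a) - 1 dvd j" for j
    using dvd gn by (auto simp: n_def power_mult)
  then show ?thesis using g0 pow by blast
qed

text \<open>For x = g^k with g primitive, x^m = 1 means that n m divides k m, that is, n divides k.
  Serves squares (n = 2) and cubes (n = 3).\<close>

lemma power_residue_criterion:
  fixes x :: "'a::finite_field"
  assumes "n * m = CARD('a) - 1" "x \<noteq> 0"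
  shows "(\<exists>y. x = y ^ n) \<longleftrightarrow> x ^ m = 1"
proof
  assume "\<exists>y. x = y ^ n"
  then obtain y where y: "x = y ^ n" by blast
  have "n > 0"
    using assms(1) card_mono[of UNIV "{0, 1 :: 'a}"] by (auto intro: Nat.gr0I)
  then have "y \<noteq> 0" using assms(2) y by auto
  then show "x ^ m = 1"
    using finite_field_power_card_minus_1[of y] assms(1) y by (simp flip: power_mult)
next
  assume *: "x ^ m = 1"
  obtain g :: 'a where g: "g \<noteq> 0" "\<And>x. x \<noteq> 0 \<Longrightarrow> \<exists>k. x = g ^ k"
      "\<And>j. g ^ j = 1 \<longleftrightarrow> CARD('a) - 1 dvd j"
    using finite_field_primitive_element[where 'a='a] by (elim exE conjE) (rule that; blast)
  obtain k where k: "x = g ^ k" using g(2)[OF assms(2)] by blast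
  have "n * m dvd k * m" using * g(3)[of "k * m"] assms(1) by (simp add: k power_mult)
  moreover have "m > 0"
    using assms(1) card_mono[of UNIV "{0, 1 :: 'a}"] by (auto intro: Nat.gr0I)
  ultimately have "n dvd k" by simp
  then show "\<exists>y. x = y ^ n" by (auto simp: k power_mult mult.commute elim!: dvdE)
qed

lemma finite_field_exists_root_of_unity:
  assumes "n dvd CARD('a::finite_field) - 1"
  shows "\<exists>\<omega> :: 'a. \<forall>j. \<omega> ^ j = 1 \<longleftrightarrow> n dvd j"
proof -
  obtain g :: 'a where g: "\<And>j. g ^ j = 1 \<longleftrightarrow> CARD('a) - 1 dvd j"
    using finite_field_primitive_element[where 'a='a] by (elim exE conjE) (rule that; blast)
  obtain m where m: "CARD('a) - 1 = n * m" using assms by (auto elim: dvdE)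
  have "m > 0"
    using m card_mono[of UNIV "{0, 1 :: 'a}"] by (auto intro: Nat.gr0I)
  then have "(g ^ m) ^ j = 1 \<longleftrightarrow> n dvd j" for j
    unfolding power_mult[symmetric] g m using \<open>m > 0\<close> by (simp add: mult.commute)
  then show ?thesis by blast
qed

text \<open>In characteristic two -1 = 1, so x^2 = 1 would force x = 1, but an element of order two
  exists.\<close>

lemma finite_field_two_neq_zero:
  assumes "2 dvd CARD('a::finite_field) - 1"
  shows "(2 :: 'a) \<noteq> 0"
proof
  assume "(2 :: 'a) = 0"
  then have neg: "(-1 :: 'a) = 1" by (metis add.right_inverse add_left_cancel one_add_one)
  obtain x :: 'a where x: "\<forall>j. x ^ j = 1 \<longleftrightarrow> 2 dvd j"
    using finite_field_exists_root_of_unity[OF assms] by blast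
  from x[rule_format, of 2] have "x = 1 \<or> x = -1" by (simp add: power2_eq_1_iff)
  then have "x = 1" unfolding neg by simp
  then show False using x[rule_format, of 1] by simp
qed

section \<open>Characters\<close>

lemma mult_char_0: "\<chi> \<in> mult_characters \<Longrightarrow> \<chi> 0 = 0"
  by (simp add: mult_characters_def)

lemma mult_char_mult: "\<chi> \<in> mult_characters \<Longrightarrow> \<chi> (x * y) = \<chi> x * \<chi> y"
  by (cases "x = 0 \<or> y = 0") (auto simp: mult_characters_def)

lemma mult_char_eq_0_iff: "\<chi> \<in> mult_characters \<Longrightarrow> \<chi> x = 0 \<longleftrightarrow> x = 0"
  by (auto simp: mult_characters_def)

lemma mult_char_1:
  assumes "\<chi> \<in> mult_characters"
  shows "\<chi> 1 = 1"
proof -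
  have "\<chi> 1 * \<chi> 1 = \<chi> 1" "\<chi> 1 \<noteq> 0"
    using mult_char_mult[OF assms, of 1 1] mult_char_eq_0_iff[OF assms, of 1] by simp_all
  then show ?thesis by simp
qed

lemma mult_char_power: "\<chi> \<in> mult_characters \<Longrightarrow> \<chi> (x ^ n) = \<chi> x ^ n"
  by (induction n) (simp_all add: mult_char_mult mult_char_1)

lemma mult_char_inverse:
  assumes "\<chi> \<in> mult_characters"
  shows "\<chi> (inverse x) = inverse (\<chi> x)"
proof (cases "x = 0")
  case False
  then have "\<chi> (inverse x) * \<chi> x = 1"
    using assms mult_char_mult[of \<chi> "inverse x" x] mult_char_1[of \<chi>] by simp
  then show ?thesis by (metis inverse_unique mult.commute)
qed (use assms mult_char_0 in force)

lemma sum_mult_char_eq_0: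
  assumes "\<chi> \<in> mult_characters" "a \<noteq> 0" "\<chi> a \<noteq> 1"
  shows "(\<Sum>x\<in>UNIV. \<chi> x) = 0"
proof -
  have "(\<Sum>x\<in>UNIV. \<chi> x) = (\<Sum>x\<in>UNIV. \<chi> (a * x))"
    by (rule sum.reindex_bij_witness[of _ "\<lambda>x. a * x" "\<lambda>x. x / a"]) (use assms in auto)
  also have "\<dots> = \<chi> a * (\<Sum>x\<in>UNIV. \<chi> x)"
    using assms by (simp add: mult_char_mult sum_distrib_left)
  finally show ?thesis using assms(3) by simp
qed

text \<open>For a character \<open>T\<close> the factor \<open>trivial_char x\<close> matters only
  when \<open>n\<close> and \<open>x\<close> are both 0: there \<open>0 ^ 0 = 1\<close>, whereas the
  neutral character vanishes.\<close>

lemma char_group_pow_apply: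
  "(T [^]\<^bsub>char_group\<^esub> (n::nat)) x = trivial_char x * T x ^ n"
proof (induction n)
  case (Suc n)
  then show ?case using monoid.nat_pow_Suc by (simp add: char_group_def)
qed (simp add: char_group_def)

lemma char_group_pow_closed:
  assumes "T \<in> mult_characters"
  shows "T [^]\<^bsub>char_group\<^esub> (n::nat) \<in> mult_characters"
  using assms by (simp add: mult_characters_def char_group_pow_apply trivial_char_def power_mult_distrib)

section \<open>Faithful characters\<close>

text \<open>Sends a primitive element to exp(2 pi i / (q - 1)). Both have order exactly q - 1, which
  makes the map well defined and its kernel trivial.\<close>

lemma exists_faithful_char:
  "\<exists>\<chi> \<in> mult_characters. \<forall>x :: 'a::finite_field. \<chi> x = 1 \<longrightarrow> x = 1"
proof -
  obtain g :: 'a where g: "g \<noteq> 0" "\<And>x. x \<noteq> 0 \<Longrightarrow> \<exists>k. x = g ^ k"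
      "\<And>j. g ^ j = 1 \<longleftrightarrow> CARD('a) - 1 dvd j"
    using finite_field_primitive_element[where 'a='a] by (elim exE conjE) (rule that; blast)
  define n where "n = CARD('a) - 1"
  have n0: "n > 0"
    using card_mono[of UNIV "{0, 1 :: 'a}"] by (simp add: n_def)
  define \<zeta> where "\<zeta> = cis (2 * pi / n)"
  have \<zeta>0: "\<zeta> \<noteq> 0" by (simp add: \<zeta>_def)
  have \<zeta>n: "\<zeta> ^ n = 1" using n0 by (simp add: \<zeta>_def DeMoivre)
  have \<zeta>dvd: "n dvd j" if "\<zeta> ^ j = 1" for j
  proof -
    have "cos (real j * (2 * pi / n)) = 1"
      using that by (simp add: \<zeta>_def DeMoivre complex_eq_iff)
    then obtain i :: int where "real j * (2 * pi / n) = i * (2 * pi)"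
      by (auto simp: cos_one_2pi_int)
    then have "real j = i * real n" using n0 by (simp add: field_simps)
    then have "int j = i * int n" by (metis of_int_eq_iff of_int_mult of_int_of_nat_eq)
    then show ?thesis by (metis dvd_triv_right int_dvd_int_iff)
  qed
  \<comment> \<open>The exponent of a power of \<open>g\<close> is determined only modulo
    \<open>n\<close>. Assuming \<open>i \<le> j\<close> avoids truncated subtraction.\<close>
  have wd: "\<zeta> ^ i = \<zeta> ^ j" if "g ^ i = g ^ j" "i \<le> j" for i j
  proof -
    have "g ^ i * g ^ (j - i) = g ^ i"
      using that by (metis le_add_diff_inverse power_add)
    then have "g ^ (j - i) = 1" using g(1) by simp
    then have "n dvd j - i" by (simp add: g(3) n_def)
    then have "\<zeta> ^ (j - i) = 1" using \<zeta>n by (auto simp: power_mult elim!: dvdE)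
    then have "\<zeta> ^ i * \<zeta> ^ (j - i) = \<zeta> ^ i" by simp
    then show ?thesis using that(2) by (simp flip: power_add)
  qed
  define \<chi> where "\<chi> x = (if x = 0 then 0 else \<zeta> ^ (SOME k. x = g ^ k))" for x
  have \<chi>g: "\<chi> (g ^ k) = \<zeta> ^ k" for k
  proof -
    have "g ^ k = g ^ (SOME l. g ^ k = g ^ l)" by (rule someI) simp
    then have "\<zeta> ^ (SOME l. g ^ k = g ^ l) = \<zeta> ^ k"
      using wd nat_le_linear by metis
    then show ?thesis using g(1) by (simp add: \<chi>_def)
  qed
  have "\<chi> (x * y) = \<chi> x * \<chi> y" if "x \<noteq> 0" "y \<noteq> 0" for x y
  proof -
    obtain i j where "x = g ^ i" "y = g ^ j" using g(2) \<open>x \<noteq> 0\<close> \<open>y \<noteq> 0\<close> by metis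
    then show ?thesis using \<chi>g[of "i + j"] by (simp add: \<chi>g power_add)
  qed
  then have "\<chi> \<in> mult_characters" using \<zeta>0 by (simp add: mult_characters_def \<chi>_def)
  moreover have "x = 1" if "\<chi> x = 1" for x
  proof -
    have "x \<noteq> 0" using that by (auto simp: \<chi>_def)
    then obtain k where "x = g ^ k" using g(2) by blast
    then show ?thesis using that \<zeta>dvd g(3) by (simp add: \<chi>g n_def)
  qed
  ultimately show ?thesis by blast
qed

text \<open>Having value 1 at \<open>x\<close> is preserved by the group operations, so it passes
  from \<open>T\<close> to every character, in particular to a faithful one.\<close>

lemma generating_char_faithful:
  fixes T :: "'a::finite_field \<Rightarrow> complex"
  assumes T: "T \<in> carrier char_group" "generate char_group {T} = carrier char_group"
    and x: "T x = 1"
  shows "x = 1"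
proof -
  have T': "T \<in> mult_characters" using T(1) by (simp add: char_group_def)
  then have x0: "x \<noteq> 0" using x mult_char_0 by fastforce
  have *: "\<chi> x = 1" if "\<chi> \<in> generate char_group {T}" for \<chi>
    using that
  proof induction
    case (inv h)
    then show ?case using T' x by (simp add: inv_char_group)
  qed (use x x0 in \<open>auto simp: char_group_def trivial_char_def\<close>)
  obtain \<chi> :: "'a \<Rightarrow> complex" where "\<chi> \<in> mult_characters" "\<And>x. \<chi> x = 1 \<Longrightarrow> x = 1"
    using exists_faithful_char[where 'a='a] by (elim bexE) (rule that; blast)
  then show ?thesis using * T(2) by (simp add: char_group_def)
qed

section \<open>The quadratic character\<close>

lemma quadratic_char_0 [simp]: "quadratic_char 0 = 0"
  by (simp add: quadratic_char_def)

lemma quadratic_char_square: "y \<noteq> 0 \<Longrightarrow> quadratic_char (y ^ 2) = 1"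
  by (auto simp: quadratic_char_def)

lemma euler_criterion_finite_field:
  fixes x :: "'a::finite_field"
  assumes "2 * m = CARD('a) - 1" "x \<noteq> 0"
  shows "x ^ m = 1 \<and> quadratic_char x = 1 \<or> x ^ m = -1 \<and> quadratic_char x = -1 \<and> x ^ m \<noteq> 1"
proof -
  have "(x ^ m) ^ 2 = 1"
    using finite_field_power_card_minus_1[OF assms(2)] assms(1)
    by (metis mult.commute power_mult)
  then have "x ^ m = 1 \<or> x ^ m = -1" by (simp add: power2_eq_1_iff)
  then show ?thesis
    using power_residue_criterion[OF assms] assms(2) by (auto simp: quadratic_char_def)
qed

lemma quadratic_char_mult_character:
  assumes "2 dvd CARD('a::finite_field) - 1"
  shows "(quadratic_char :: 'a \<Rightarrow> complex) \<in> mult_characters"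
proof -
  obtain m where m: "2 * m = CARD('a) - 1" using assms by (metis dvdE)
  have m1: "(-1 :: 'a) \<noteq> 1"
    using finite_field_two_neq_zero[OF assms] by (metis add.right_inverse one_add_one)
  have "quadratic_char (x * y) = quadratic_char x * quadratic_char y"
    if "x \<noteq> 0" "y \<noteq> 0" for x y :: 'a
    using euler_criterion_finite_field[OF m that(1)] euler_criterion_finite_field[OF m that(2)]
      euler_criterion_finite_field[OF m, of "x * y"] that m1
    by (auto simp: power_mult_distrib)
  then show ?thesis by (simp add: mult_characters_def quadratic_char_def)
qed

lemma finite_field_exists_nonsquare:
  assumes "2 dvd CARD('a::finite_field) - 1"
  shows "\<exists>x :: 'a. quadratic_char x = -1"
proof -
  obtain m where m: "2 * m = CARD('a) - 1" using assms by (metis dvdE)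
  have "m > 0"
    using m card_mono[of UNIV "{0, 1 :: 'a}"] by (auto intro: Nat.gr0I)
  \<comment> \<open>A primitive element has order 2m, so its m-th power is not 1 and the Euler
    criterion makes it a nonsquare.\<close>
  obtain x :: 'a where x: "\<forall>j. x ^ j = 1 \<longleftrightarrow> CARD('a) - 1 dvd j"
    using finite_field_exists_root_of_unity[OF dvd_refl] by blast
  have "x ^ (2 * m) = 1" using x m by simp
  then have "x \<noteq> 0" using \<open>m > 0\<close> by (auto simp: power_0_left)
  moreover have "x ^ m \<noteq> 1"
    using x[rule_format, of m, folded m] \<open>m > 0\<close> by (auto dest: dvd_imp_le)
  ultimately show ?thesis using euler_criterion_finite_field[OF m] by blast
qed

lemma sum_quadratic_char:
  assumes "2 dvd CARD('a::finite_field) - 1"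
  shows "(\<Sum>x\<in>UNIV. quadratic_char (x :: 'a)) = 0"
proof -
  obtain a :: 'a where "quadratic_char a = -1"
    using finite_field_exists_nonsquare[OF assms] by blast
  moreover from this have "a \<noteq> 0" by auto
  ultimately show ?thesis
    using sum_mult_char_eq_0[OF quadratic_char_mult_character[OF assms]] by simp
qed

lemma card_square_roots:
  fixes D :: "'a::finite_field"
  assumes "2 dvd CARD('a) - 1"
  shows "of_nat (card {x. x ^ 2 = D}) = 1 + quadratic_char D"
proof (cases "\<exists>y. D = y ^ 2")
  case True
  then obtain y where y: "D = y ^ 2" by blast
  have *: "{x. x ^ 2 = y ^ 2} = {y, - y}" by (auto simp: power2_eq_iff)
  show ?thesis
  proof (cases "y = 0")
    case False
    then have "y \<noteq> - y"
      using finite_field_two_neq_zero[OF assms] by (simp add: eq_neg_iff_add_eq_0 flip: mult_2)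
    then show ?thesis using False by (simp add: y * quadratic_char_square)
  qed (simp add: y)
next
  case False
  then have "{x. x ^ 2 = D} = {}" "D \<noteq> 0" by (auto intro: exI[of _ 0])
  then show ?thesis using False by (simp add: quadratic_char_def)
qed

text \<open>Completing the square: x -> 2 \<alpha> x + \<beta> maps the roots bijectively to the
  square roots of the discriminant.\<close>

lemma card_quadratic_roots:
  fixes \<alpha> \<beta> \<gamma> :: "'a::finite_field"
  assumes "2 dvd CARD('a) - 1" "\<alpha> \<noteq> 0"
  shows "of_nat (card {x. \<alpha> * x ^ 2 + \<beta> * x + \<gamma> = 0}) = 1 + quadratic_char (\<beta> ^ 2 - 4 * \<alpha> * \<gamma>)"
proof -
  note two = finite_field_two_neq_zero[OF assms(1)]
  then have four: "(4 :: 'a) \<noteq> 0"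
    by (metis mult_eq_0_iff numeral_Bit0 mult_2)
  have iff: "\<alpha> * x ^ 2 + \<beta> * x + \<gamma> = 0 \<longleftrightarrow> (2 * \<alpha> * x + \<beta>) ^ 2 = \<beta> ^ 2 - 4 * \<alpha> * \<gamma>" for x
  proof -
    have "(2 * \<alpha> * x + \<beta>) ^ 2 - (\<beta> ^ 2 - 4 * \<alpha> * \<gamma>) = 4 * \<alpha> * (\<alpha> * x ^ 2 + \<beta> * x + \<gamma>)"
      by (simp add: power2_eq_square algebra_simps)
    then show ?thesis using assms(2) four by (metis eq_iff_diff_eq_0 mult_eq_0_iff)
  qed
  have "bij_betw (\<lambda>x. 2 * \<alpha> * x + \<beta>) {x. \<alpha> * x ^ 2 + \<beta> * x + \<gamma> = 0} {x. x ^ 2 = \<beta> ^ 2 - 4 * \<alpha> * \<gamma>}"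
    by (rule bij_betw_byWitness[of _ "\<lambda>y. (y - \<beta>) / (2 * \<alpha>)"])
       (use two assms(2) in \<open>auto simp: iff\<close>)
  then show ?thesis
    using card_square_roots[OF assms(1), of "\<beta> ^ 2 - 4 * \<alpha> * \<gamma>"] bij_betw_same_card by fastforce
qed

text \<open>Tool for substitutions that are not bijective: fibre sizes become weights, and these are
  then expressed by characters.\<close>

lemma sum_card_fibres:
  fixes f :: "'b::finite \<Rightarrow> complex"
  assumes "finite A"
  shows "(\<Sum>x\<in>A. f (g x)) = (\<Sum>r\<in>UNIV. of_nat (card {x\<in>A. g x = r}) * f r)"
proof -
  have "(\<Sum>x\<in>A. f (g x)) = (\<Sum>r\<in>UNIV. \<Sum>x\<in>{x\<in>A. g x = r}. f (g x))"
    using assms by (intro sum.group[symmetric]) auto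
  also have "\<dots> = (\<Sum>r\<in>UNIV. of_nat (card {x\<in>A. g x = r}) * f r)"
    by (intro sum.cong) auto
  finally show ?thesis .
qed

section \<open>Cardano's formula as an identity of sums\<close>

text \<open>The fibre over s is the root set of w^2 - s w + 1, of discriminant s^2 - 4; its constant
  term 1 keeps w away from 0.\<close>

lemma sum_add_inverse:
  fixes F :: "'a::finite_field \<Rightarrow> complex"
  assumes "2 dvd CARD('a) - 1"
  shows "(\<Sum>w\<in>-{0}. F (w + inverse w)) = (\<Sum>s\<in>UNIV. (1 + quadratic_char (s ^ 2 - 4)) * F s)"
proof -
  have "of_nat (card {w \<in> -{0}. w + inverse w = s}) = 1 + quadratic_char (s ^ 2 - 4)" for s :: 'a
  proof -
    have "w \<noteq> 0 \<and> w + inverse w = s \<longleftrightarrow> 1 * w ^ 2 + (- s) * w + 1 = 0" for w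
    proof (cases "w = 0")
      case False
      then have "1 * w ^ 2 + (- s) * w + 1 = w * (w + inverse w - s)"
        by (simp add: power2_eq_square algebra_simps)
      then show ?thesis using False by simp
    qed simp
    then have "{w \<in> -{0}. w + inverse w = s} = {w. 1 * w ^ 2 + (- s) * w + 1 = 0}"
      by auto
    then show ?thesis using card_quadratic_roots[OF assms, of 1 "- s" 1] by simp
  qed
  then show ?thesis by (subst sum_card_fibres) simp_all
qed

lemma sum_cube:
  fixes F \<eta> :: "'a::finite_field \<Rightarrow> complex"
  assumes "\<And>v. v \<noteq> 0 \<Longrightarrow> of_nat (card {w. w ^ 3 = v}) = 1 + \<eta> v + \<eta> v ^ 2"
  shows "(\<Sum>w\<in>-{0}. F (w ^ 3)) = (\<Sum>v\<in>-{0}. (1 + \<eta> v + \<eta> v ^ 2) * F v)"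
proof -
  have "(\<Sum>w\<in>-{0}. F (w ^ 3)) = (\<Sum>v\<in>UNIV. of_nat (card {w \<in> -{0}. w ^ 3 = v}) * F v)"
    by (rule sum_card_fibres) simp
  also have "\<dots> = (\<Sum>v\<in>-{0}. of_nat (card {w \<in> -{0}. w ^ 3 = v}) * F v)"
    by (rule sum.mono_neutral_right) auto
  also have "\<dots> = (\<Sum>v\<in>-{0}. (1 + \<eta> v + \<eta> v ^ 2) * F v)"
  proof (rule sum.cong)
    fix v :: 'a assume "v \<in> -{0}"
    then have "{w \<in> -{0}. w ^ 3 = v} = {w. w ^ 3 = v}" by auto
    then show "of_nat (card {w \<in> -{0}. w ^ 3 = v}) * F v = (1 + \<eta> v + \<eta> v ^ 2) * F v"
      using assms \<open>v \<in> -{0}\<close> by simp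
  qed simp
  finally show ?thesis .
qed

lemma finite_field_exists_cube_root_of_unity:
  assumes "3 dvd CARD('a::finite_field) - 1"
  shows "\<exists>\<omega> :: 'a. \<omega> \<noteq> 1 \<and> \<omega> ^ 3 = 1 \<and> \<omega> ^ 2 + \<omega> + 1 = 0"
proof -
  obtain \<omega> :: 'a where w: "\<forall>j. \<omega> ^ j = 1 \<longleftrightarrow> 3 dvd j"
    using finite_field_exists_root_of_unity[OF assms] by blast
  have 1: "\<omega> \<noteq> 1" using w[rule_format, of 1] by auto
  have 3: "\<omega> ^ 3 = 1" using w[rule_format, of 3] by simp
  have "(\<omega> - 1) * (\<omega> ^ 2 + \<omega> + 1) = \<omega> ^ 3 - 1"
    by (simp add: power2_eq_square power3_eq_cube algebra_simps)
  then show ?thesis using 1 3 by auto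
qed

text \<open>In characteristic three \<omega>^2 + \<omega> + 1 = (\<omega> - 1)^2, so no primitive
  cube root of unity could exist.\<close>

lemma finite_field_three_neq_zero:
  assumes "3 dvd CARD('a::finite_field) - 1"
  shows "(3 :: 'a) \<noteq> 0"
proof
  assume 3: "(3 :: 'a) = 0"
  obtain \<omega> :: 'a where w: "\<omega> \<noteq> 1" "\<omega> ^ 2 + \<omega> + 1 = 0"
    using finite_field_exists_cube_root_of_unity[OF assms] by blast
  have "(\<omega> - 1) ^ 2 = (\<omega> ^ 2 + \<omega> + 1) - 3 * \<omega>"
    by (simp add: power2_eq_square algebra_simps)
  then show False using w 3 by simp
qed

text \<open>On \<open>{s. s\<^sup>2 - 4 nonsquare}\<close> the map \<open>s \<mapsto> s\<^sup>3 - 3s\<close> is a permutation: a second preimage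
  of the same value would make \<open>-3 (s\<^sup>2 - 4)\<close> a square, and \<open>-3\<close> is one.
  The points \<open>\<plusminus>2\<close> are fixed.\<close>

lemma sum_cubic_nonsquare:
  fixes F :: "'a::finite_field \<Rightarrow> complex"
  assumes two: "2 dvd CARD('a) - 1" and three: "3 dvd CARD('a) - 1"
  shows "(\<Sum>s\<in>UNIV. (1 - quadratic_char (s ^ 2 - 4)) * F (s ^ 3 - 3 * s)) =
         (\<Sum>r\<in>UNIV. (1 - quadratic_char (r ^ 2 - 4)) * F r)"
proof -
  define P :: "'a \<Rightarrow> 'a" where "P s = s ^ 3 - 3 * s" for s
  \<comment> \<open>Outside \<open>N\<close> the weight
    \<open>1 - quadratic_char (s ^ 2 - 4)\<close> is 0. The points with s^2 = 4 belong to
    \<open>N\<close>, with weight 1.\<close>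
  define N :: "'a set" where "N = {s. quadratic_char (s ^ 2 - 4) \<noteq> 1}"
  obtain \<omega> :: 'a where w: "\<omega> ^ 2 + \<omega> + 1 = 0"
    using finite_field_exists_cube_root_of_unity[OF three] by blast
  \<comment> \<open>A square root of -3.\<close>
  define \<theta> where "\<theta> = 2 * \<omega> + 1"
  have "\<theta> ^ 2 = 4 * (\<omega> ^ 2 + \<omega> + 1) - 3"
    by (simp add: \<theta>_def power2_eq_square algebra_simps)
  then have \<theta>: "\<theta> ^ 2 = - 3" using w by simp
  have three0: "(3 :: 'a) \<noteq> 0" by (rule finite_field_three_neq_zero[OF three])
  have two0: "(2 :: 'a) \<noteq> 0" by (rule finite_field_two_neq_zero[OF two])
  have \<theta>0: "\<theta> \<noteq> 0" using \<theta> three0 by auto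
  have not_square: "y = 0" if "s \<in> N" "s ^ 2 - 4 = y ^ 2" for s y
    using that quadratic_char_square[of y] by (auto simp: N_def)
  \<comment> \<open>If s^2 = 1, then s^2 - 4 = -3 is the nonzero square of
    \<open>\<theta>\<close>.\<close>
  have s1: "s ^ 2 \<noteq> 1" if "s \<in> N" for s
    using not_square[OF that, of \<theta>] \<theta> \<theta>0 by auto
  have QP: "quadratic_char (P s ^ 2 - 4) = quadratic_char (s ^ 2 - 4)" if "s \<in> N" for s
  proof -
    have "P s ^ 2 - 4 = (s ^ 2 - 4) * (s ^ 2 - 1) ^ 2"
      by (simp add: P_def power2_eq_square power3_eq_cube algebra_simps)
    then show ?thesis
      using mult_char_mult[OF quadratic_char_mult_character[OF two]] s1[OF that]
      by (simp add: quadratic_char_square)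
  qed
  have inj: "inj_on P N"
  proof (rule inj_onI, rule ccontr)
    fix s t assume st: "s \<in> N" "t \<in> N" "P s = P t" "s \<noteq> t"
    have "(s - t) * (s ^ 2 + s * t + t ^ 2 - 3) = P s - P t"
      by (simp add: P_def power2_eq_square power3_eq_cube algebra_simps)
    then have q: "s ^ 2 + s * t + t ^ 2 - 3 = 0" using st by simp
    \<comment> \<open>As a quadratic in \<open>t\<close>, the relation has discriminant -3 (s^2 -
      4). So s^2 - 4 is a square, hence 0 on \<open>N\<close>; then s = -2t gives t^2 = 1, which
      \<open>s1\<close> excludes.\<close>
    have "(2 * t + s) ^ 2 = 4 * (s ^ 2 + s * t + t ^ 2 - 3) - 3 * (s ^ 2 - 4)"
      by (simp add: power2_eq_square algebra_simps)
    then have "(2 * t + s) ^ 2 = \<theta> ^ 2 * (s ^ 2 - 4)" using q \<theta> by simp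
    then have sq: "s ^ 2 - 4 = ((2 * t + s) / \<theta>) ^ 2" using \<theta>0 by (simp add: power_divide)
    from not_square[OF st(1) sq] have "2 * t + s = 0" using \<theta>0 by simp
    then have s: "s = - 2 * t" by (simp add: add_eq_0_iff)
    from sq \<open>2 * t + s = 0\<close> have "s ^ 2 - 4 = 0" by simp
    then have "2 * 2 * (t ^ 2 - 1) = 0" by (simp add: s power_mult_distrib algebra_simps)
    then have "t ^ 2 = 1" using two0 by (metis eq_iff_diff_eq_0 mult_eq_0_iff)
    then show False using s1 st(2) by blast
  qed
  have sub: "P ` N \<subseteq> N" using QP by (auto simp: N_def)
  then have img: "P ` N = N" using inj by (intro endo_inj_surj) auto
  have "(\<Sum>s\<in>UNIV. (1 - quadratic_char (s ^ 2 - 4)) * F (P s)) =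
        (\<Sum>s\<in>N. (1 - quadratic_char (s ^ 2 - 4)) * F (P s))"
    by (rule sum.mono_neutral_right) (auto simp: N_def)
  also have "\<dots> = (\<Sum>s\<in>N. (1 - quadratic_char (P s ^ 2 - 4)) * F (P s))"
    by (rule sum.cong) (auto simp: QP)
  also have "\<dots> = (\<Sum>r\<in>P ` N. (1 - quadratic_char (r ^ 2 - 4)) * F r)"
    by (simp add: sum.reindex[OF inj])
  also have "\<dots> = (\<Sum>r\<in>UNIV. (1 - quadratic_char (r ^ 2 - 4)) * F r)"
    unfolding img by (rule sum.mono_neutral_left) (auto simp: N_def)
  finally show ?thesis by (simp add: P_def)
qed

text \<open>The substitution s = w + 1/w only reaches s with s^2 - 4 a square and thus computes the
  sum with weight 1 + \<phi>(s^2 - 4). The complementary weight is handled by the permutation s ->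
  s^3 - 3s, and adding the two removes the weights.\<close>

lemma sum_cubic_eq:
  fixes F \<eta> :: "'a::finite_field \<Rightarrow> complex"
  assumes two: "2 dvd CARD('a) - 1" and three: "3 dvd CARD('a) - 1"
    and \<eta>: "\<eta> \<in> mult_characters"
    and card: "\<And>v. v \<noteq> 0 \<Longrightarrow> of_nat (card {w. w ^ 3 = v}) = 1 + \<eta> v + \<eta> v ^ 2"
    and cube: "\<And>v. v \<noteq> 0 \<Longrightarrow> \<eta> v ^ 3 = 1"
  shows "(\<Sum>s\<in>UNIV. F (s ^ 3 - 3 * s)) =
         (\<Sum>r\<in>UNIV. F r) + (\<Sum>v\<in>-{0}. \<eta> v * F (v + inverse v))"
proof -
  have cubic_identity: "(w + w') ^ 3 - 3 * (w + w') = w ^ 3 + w' ^ 3 + 3 * (w * w' - 1) * (w + w')" for w w' :: 'a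
    by (simp add: power3_eq_cube algebra_simps)
  let ?G = "\<Sum>v\<in>-{0}. \<eta> v * F (v + inverse v)"
  have "(\<Sum>s\<in>UNIV. (1 + quadratic_char (s ^ 2 - 4)) * F (s ^ 3 - 3 * s)) =
        (\<Sum>w\<in>-{0}. F ((w + inverse w) ^ 3 - 3 * (w + inverse w)))"
    by (rule sum_add_inverse[OF two, symmetric])
  also have "\<dots> = (\<Sum>w\<in>-{0}. F (w ^ 3 + inverse (w ^ 3)))"
  proof (rule sum.cong)
    fix w :: 'a assume "w \<in> -{0}"
    then have "(w + inverse w) ^ 3 - 3 * (w + inverse w) = w ^ 3 + inverse (w ^ 3)"
      using cubic_identity[of w "inverse w"] by (simp add: power_inverse)
    then show "F ((w + inverse w) ^ 3 - 3 * (w + inverse w)) = F (w ^ 3 + inverse (w ^ 3))"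
      by simp
  qed simp
  also have "\<dots> = (\<Sum>v\<in>-{0}. (1 + \<eta> v + \<eta> v ^ 2) * F (v + inverse v))"
    by (rule sum_cube) (rule card)
  also have "\<dots> = (\<Sum>v\<in>-{0}. F (v + inverse v)) + ?G + (\<Sum>v\<in>-{0}. \<eta> v ^ 2 * F (v + inverse v))"
    by (simp add: distrib_right sum.distrib)
  \<comment> \<open>Inversion fixes v + 1/v and exchanges \<eta> with \<eta>^2, because \<eta>^3 = 1
    on units.\<close>
  also have "(\<Sum>v\<in>-{0}. \<eta> v ^ 2 * F (v + inverse v)) = ?G"
  proof (rule sum.reindex_bij_witness[of _ inverse inverse])
    fix v :: 'a assume v: "v \<in> -{0}"
    then have "inverse (\<eta> v) = \<eta> v ^ 2"
      using cube[of v] by (intro inverse_unique) (simp add: power3_eq_cube power2_eq_square mult.assoc)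
    then show "\<eta> (inverse v) * F (inverse v + inverse (inverse v)) = \<eta> v ^ 2 * F (v + inverse v)"
      by (simp add: mult_char_inverse[OF \<eta>] add.commute)
  qed auto
  also have "(\<Sum>v\<in>-{0}. F (v + inverse v)) = (\<Sum>r\<in>UNIV. (1 + quadratic_char (r ^ 2 - 4)) * F r)"
    by (rule sum_add_inverse[OF two])
  \<comment> \<open>The sums with weight 1 - \<phi> are added on both sides, so that each pair of
    weights totals 2.\<close>
  finally have
    *: "(\<Sum>s\<in>UNIV. (1 + quadratic_char (s ^ 2 - 4)) * F (s ^ 3 - 3 * s)) +
     (\<Sum>s\<in>UNIV. (1 - quadratic_char (s ^ 2 - 4)) * F (s ^ 3 - 3 * s)) =
     (\<Sum>r\<in>UNIV. (1 + quadratic_char (r ^ 2 - 4)) * F r) + ?G + ?G +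
     (\<Sum>r\<in>UNIV. (1 - quadratic_char (r ^ 2 - 4)) * F r)"
    using sum_cubic_nonsquare[OF two three, of F] by simp
  have collect: "(\<Sum>x\<in>UNIV. (1 + Q x) * f x) + (\<Sum>x\<in>UNIV. (1 - Q x) * f x) = 2 * (\<Sum>x\<in>UNIV. f x)"
    for Q f :: "'a \<Rightarrow> complex"
    by (simp add: algebra_simps sum.distrib sum_subtractf)
  have "2 * (\<Sum>s\<in>UNIV. F (s ^ 3 - 3 * s)) =
      (\<Sum>s\<in>UNIV. (1 + quadratic_char (s ^ 2 - 4)) * F (s ^ 3 - 3 * s)) +
      (\<Sum>s\<in>UNIV. (1 - quadratic_char (s ^ 2 - 4)) * F (s ^ 3 - 3 * s))"
    by (rule collect[symmetric])
  also note *
  also have "(\<Sum>r\<in>UNIV. (1 + quadratic_char (r ^ 2 - 4)) * F r) + ?G + ?G +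
      (\<Sum>r\<in>UNIV. (1 - quadratic_char (r ^ 2 - 4)) * F r) =
      2 * (\<Sum>r\<in>UNIV. F r) + 2 * ?G"
    unfolding collect[of "\<lambda>r. quadratic_char (r ^ 2 - 4)" F, symmetric] by (simp only: mult_2 ac_simps)
  also have "\<dots> = 2 * ((\<Sum>r\<in>UNIV. F r) + ?G)" by (rule distrib_left[symmetric])
  finally show ?thesis by (simp only: mult_cancel_left) simp
qed

section \<open>Greene's series with parameters of order six\<close>

text \<open>Grouping by v = y (1 - z y) / (1 - y) gives fibres of size 1 + \<phi>((1 + v)^2 - 4 z
  v). The 1 contributes the sum of \<open>B\<close>, which is 0. Extracting \<phi>(v) = B(v)^3 from
  the rest leaves the cubic weight B(v)^4.\<close>

lemma greene_2F1_order_six: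
  fixes B :: "'a::finite_field \<Rightarrow> complex"
  assumes two: "2 dvd CARD('a) - 1"
    and B: "B \<in> mult_characters"
    and cube: "\<And>x. B x ^ 3 = quadratic_char x"
    and z: "z \<noteq> 0" "z \<noteq> 1"
  shows "of_nat CARD('a) * greene_2F1 (\<lambda>x. inverse (B x)) B trivial_char z =
    quadratic_char (-1 :: 'a) *
    (\<Sum>v\<in>-{0}. B v ^ 4 * quadratic_char (v + inverse v + (2 - 4 * z)))"
proof -
  note qm = mult_char_mult[OF quadratic_char_mult_character[OF two]]
  have "B (-1) ^ 2 = 1"
    using mult_char_power[OF B, of "-1" 2] mult_char_1[OF B] by simp
  then have Bm1: "B (-1) = quadratic_char (-1 :: 'a)"
    using cube[of "-1"] by (simp only: power3_eq_cube power2_eq_square mult_1)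
  have sumB: "(\<Sum>v\<in>UNIV. B v) = 0"
  proof -
    \<comment> \<open>\<open>B\<close> is nontrivial because its cube is -1 at a nonsquare.\<close>
    obtain a :: 'a where a: "quadratic_char a = -1"
      using finite_field_exists_nonsquare[OF two] by blast
    then have "a \<noteq> 0" "B a \<noteq> 1" using cube[of a] by auto
    then show ?thesis by (rule sum_mult_char_eq_0[OF B])
  qed
  \<comment> \<open>Also valid at \<open>y = 1\<close>: division by zero yields 0, so both sides
    vanish.\<close>
  have summand: "B y * inverse (B (1 - y)) * B (1 - z * y) = B (y * (1 - z * y) / (1 - y))" for y
    by (simp add: divide_inverse mult_char_mult[OF B] mult_char_inverse[OF B] mult_ac)
  have fibre: "of_nat (card {y \<in> -{1}. y * (1 - z * y) / (1 - y) = v}) =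
      1 + quadratic_char ((1 + v) ^ 2 - 4 * z * v)" for v :: 'a
  proof -
    \<comment> \<open>At y = 1 the quadratic has the value z - 1, so \<open>z \<noteq> 1\<close>
      keeps the excluded point from being a root.\<close>
    have "y \<noteq> 1 \<and> y * (1 - z * y) / (1 - y) = v \<longleftrightarrow> z * y ^ 2 + (- (1 + v)) * y + v = 0" for y
    proof (cases "y = 1")
      case False
      then have "y * (1 - z * y) / (1 - y) = v \<longleftrightarrow> y * (1 - z * y) = v * (1 - y)"
        by (simp add: divide_eq_eq)
      also have "\<dots> \<longleftrightarrow> z * y ^ 2 + (- (1 + v)) * y + v = 0"
        by (auto simp: power2_eq_square algebra_simps)
      finally show ?thesis using False by simp
    qed (use z in simp)
    then have "{y \<in> -{1}. y * (1 - z * y) / (1 - y) = v} = {y. z * y ^ 2 + (- (1 + v)) * y + v = 0}"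
      by auto
    then show ?thesis
      using card_quadratic_roots[OF two z(1), of "- (1 + v)" v] by (simp only: power2_minus)
  qed
  have "(\<Sum>y\<in>UNIV. B y * inverse (B (1 - y)) * B (1 - z * y)) =
        (\<Sum>y\<in>-{1}. B (y * (1 - z * y) / (1 - y)))"
    unfolding summand by (rule sum.mono_neutral_right) (auto simp: mult_char_0[OF B])
  also have "\<dots> = (\<Sum>v\<in>UNIV. (1 + quadratic_char ((1 + v) ^ 2 - 4 * z * v)) * B v)"
    by (subst sum_card_fibres) (simp_all only: fibre finite)
  also have "\<dots> = (\<Sum>v\<in>UNIV. quadratic_char ((1 + v) ^ 2 - 4 * z * v) * B v)"
    by (simp add: distrib_right sum.distrib sumB)
  also have "\<dots> = (\<Sum>v\<in>-{0}. quadratic_char ((1 + v) ^ 2 - 4 * z * v) * B v)"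
    by (rule sum.mono_neutral_right) (auto simp: mult_char_0[OF B])
  also have "\<dots> = (\<Sum>v\<in>-{0}. B v ^ 4 * quadratic_char (v + inverse v + (2 - 4 * z)))"
  proof (rule sum.cong)
    fix v :: 'a assume v: "v \<in> -{0}"
    then have v0: "v \<noteq> 0" by simp
    have "v * inverse v = 1" using v0 by simp
    then have "(1 + v) ^ 2 - 4 * z * v = v * (v + inverse v + (2 - 4 * z))"
      by (simp add: power2_eq_square algebra_simps)
    then have "quadratic_char ((1 + v) ^ 2 - 4 * z * v) * B v =
        B v ^ 3 * quadratic_char (v + inverse v + (2 - 4 * z)) * B v"
      by (simp add: qm cube)
    then show "quadratic_char ((1 + v) ^ 2 - 4 * z * v) * B v =
        B v ^ 4 * quadratic_char (v + inverse v + (2 - 4 * z))"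
      by (simp add: power3_eq_cube power4_eq_xxxx mult_ac)
  qed simp
  finally have main: "(\<Sum>y\<in>UNIV. B y * inverse (B (1 - y)) * B (1 - z * y)) =
    (\<Sum>v\<in>-{0}. B v ^ 4 * quadratic_char (v + inverse v + (2 - 4 * z)))" .
  have inv: "inv\<^bsub>char_group\<^esub> (\<lambda>x. inverse (B x)) = B"
    using inv_char_group[OF inverse_in_mult_characters[OF B]] by simp
  \<comment> \<open>\<open>trivial_char (1 - y)\<close> differs from 1 only at \<open>y = 1\<close>,
    where \<open>inverse (B 0)\<close> is already 0.\<close>
  have "(\<Sum>y\<in>UNIV. B y * (inverse (B (1 - y)) * trivial_char (1 - y)) * B (1 - z * y)) =
     (\<Sum>y\<in>UNIV. B y * inverse (B (1 - y)) * B (1 - z * y))"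
    by (rule sum.cong) (auto simp: trivial_char_def mult_char_0[OF B])
  then show ?thesis
    using main z by (simp add: greene_2F1_def inv inv_char_group[OF B] Bm1) (simp add: char_group_def trivial_char_def Bm1)
qed

section \<open>Cube roots and powers of a generating character\<close>

text \<open>x^3 - y^3 splits into linear factors with roots y, \<omega> y, \<omega>^2 y, which are
  distinct.\<close>

lemma card_cube_roots:
  fixes y :: "'a::finite_field"
  assumes "3 dvd CARD('a) - 1" "y \<noteq> 0"
  shows "card {w. w ^ 3 = y ^ 3} = 3"
proof -
  obtain \<omega> :: 'a where w: "\<omega> \<noteq> 1" "\<omega> ^ 3 = 1" "\<omega> ^ 2 + \<omega> + 1 = 0"
    using finite_field_exists_cube_root_of_unity[OF assms(1)] by blast
  then have w0: "\<omega> \<noteq> 0" by auto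
  have w2: "\<omega> ^ 2 = - \<omega> - 1" using w(3) by (simp add: eq_neg_iff_add_eq_0 algebra_simps)
  have "x ^ 3 - y ^ 3 = (x - y) * (x - \<omega> * y) * (x - \<omega> ^ 2 * y)" for x
  proof -
    have "(x - y) * (x - \<omega> * y) * (x - \<omega> ^ 2 * y) =
        x ^ 3 - \<omega> ^ 3 * y ^ 3 - x ^ 2 * y * (\<omega> ^ 2 + \<omega> + 1) + x * y ^ 2 * (\<omega> ^ 3 - 1 + (\<omega> ^ 2 + \<omega> + 1))"
      by (simp add: power2_eq_square power3_eq_cube algebra_simps)
    then show ?thesis using w by simp
  qed
  then have "x ^ 3 = y ^ 3 \<longleftrightarrow> x = y \<or> x = \<omega> * y \<or> x = \<omega> ^ 2 * y" for x
    by (metis eq_iff_diff_eq_0 mult_eq_0_iff)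
  then have "{x. x ^ 3 = y ^ 3} = {y, \<omega> * y, \<omega> ^ 2 * y}" by blast
  moreover have "\<omega> ^ 2 \<noteq> \<omega>" using w(1) w0 by (simp add: power2_eq_square)
  moreover have "\<omega> ^ 2 \<noteq> 1"
    using w(1,2) by (auto simp: power2_eq_square power3_eq_cube)
  ultimately show ?thesis using w(1) assms(2) by simp
qed

text \<open>Exponents of \<open>T\<close> count modulo 6k: k + 5k = 6k makes \<open>B\<close>
  inverse to T^k, 15k reduces to 3k (the quadratic character), and 20k reduces to 2k (a cubic
  character). Faithfulness ensures that these have exact orders 2 and 3.\<close>

lemma generating_char_power:
  fixes T :: "'a::finite_field \<Rightarrow> complex"
  assumes k: "CARD('a) - 1 = 6 * k"
    and T: "T \<in> mult_characters" and faithful: "\<And>x. T x = 1 \<Longrightarrow> x = 1"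
    and B_def: "B = T [^]\<^bsub>char_group\<^esub> (5 * k)"
  shows "B \<in> mult_characters"
    and "T [^]\<^bsub>char_group\<^esub> k = (\<lambda>x. inverse (B x))"
    and "B x ^ 3 = quadratic_char x"
    and "v \<noteq> 0 \<Longrightarrow> (B v ^ 4) ^ 3 = 1"
    and "v \<noteq> 0 \<Longrightarrow> of_nat (card {w. w ^ 3 = v}) = 1 + B v ^ 4 + (B v ^ 4) ^ 2"
proof -
  have two: "2 dvd CARD('a) - 1" and three: "3 dvd CARD('a) - 1" unfolding k by simp_all
  show B: "B \<in> mult_characters" unfolding B_def by (rule char_group_pow_closed[OF T])
  have Bx: "B x = T (x ^ (5 * k))" if "x \<noteq> 0" for x
    using that by (simp add: B_def char_group_pow_apply trivial_char_def mult_char_power[OF T])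
  have one: "x ^ (6 * k * n) = 1" if "x \<noteq> 0" for x :: 'a and n
    using finite_field_power_card_minus_1[OF that, unfolded k] by (simp only: power_mult power_one)
  have "(T [^]\<^bsub>char_group\<^esub> k) x = inverse (B x)" for x
  proof (cases "x = 0")
    case False
    have "T (x ^ k) * B x = T (x ^ (6 * k * 1))"
      by (simp add: Bx False flip: mult_char_mult[OF T] power_add)
    then have "B x * T (x ^ k) = 1" using one[OF False, of 1] mult_char_1[OF T] by (simp add: mult.commute)
    then have "inverse (B x) = T (x ^ k)" by (rule inverse_unique)
    then show ?thesis using False by (simp add: char_group_pow_apply trivial_char_def mult_char_power[OF T])
  qed (simp add: mult_char_0[OF B] char_group_pow_apply trivial_char_def)
  then show "T [^]\<^bsub>char_group\<^esub> k = (\<lambda>x. inverse (B x))" by blast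
  \<comment> \<open>T(-1) squares to 1, and faithfulness rules out the value 1.\<close>
  have Tm1: "T (-1) = -1"
  proof -
    have "T (-1) ^ 2 = 1" using mult_char_power[OF T, of "-1" 2] mult_char_1[OF T] by simp
    moreover have "T (-1) \<noteq> 1"
    proof
      assume "T (-1) = 1"
      then have "(-1 :: 'a) = 1" by (rule faithful)
      then show False
        using finite_field_two_neq_zero[OF two] by (metis add.right_inverse one_add_one)
    qed
    ultimately show ?thesis by (simp add: power2_eq_1_iff)
  qed
  show "B x ^ 3 = quadratic_char x"
  proof (cases "x = 0")
    case False
    have m: "2 * (3 * k) = CARD('a) - 1" using k by simp
    have "B x ^ 3 = T (x ^ (6 * k * 2) * x ^ (3 * k))"
      by (simp add: Bx False flip: mult_char_power[OF T] power_mult power_add)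
    also have "\<dots> = T (x ^ (3 * k))" using one[OF False, of 2] by simp
    also have "\<dots> = quadratic_char x"
      using euler_criterion_finite_field[OF m False] Tm1 mult_char_1[OF T] by auto
    finally show ?thesis .
  qed (simp add: mult_char_0[OF B])
  have B4: "B v ^ 4 = T (v ^ (2 * k))" if "v \<noteq> 0" for v
  proof -
    have "B v ^ 4 = T (v ^ (6 * k * 3) * v ^ (2 * k))"
      by (simp add: Bx that flip: mult_char_power[OF T] power_mult power_add)
    then show ?thesis using one[OF that, of 3] by simp
  qed
  show cube: "(B v ^ 4) ^ 3 = 1" if "v \<noteq> 0" for v
  proof -
    have "(B v ^ 4) ^ 3 = T (v ^ (6 * k * 1))"
      by (simp add: B4 that flip: mult_char_power[OF T] power_mult)
    then show ?thesis using one[OF that, of 1] mult_char_1[OF T] by simp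
  qed
  assume v: "v \<noteq> 0"
  have m: "3 * (2 * k) = CARD('a) - 1" using k by simp
  show "of_nat (card {w. w ^ 3 = v}) = 1 + B v ^ 4 + (B v ^ 4) ^ 2"
  proof (cases "\<exists>y. v = y ^ 3")
    case True
    then obtain y where y: "v = y ^ 3" by blast
    then have "y \<noteq> 0" using v by auto
    moreover have "B v ^ 4 = 1"
      using power_residue_criterion[OF m v] True mult_char_1[OF T] by (simp add: B4 v)
    ultimately show ?thesis using card_cube_roots[OF three, of y] by (simp add: y)
  next
    case False
    \<comment> \<open>At a noncube, B(v)^4 is a cube root of unity other than 1, so its powers 0, 1,
      2 add up to 0.\<close>
    then have "B v ^ 4 \<noteq> 1"
      using power_residue_criterion[OF m v] faithful by (auto simp: B4 v)
    moreover have "(B v ^ 4 - 1) * (1 + B v ^ 4 + (B v ^ 4) ^ 2) = (B v ^ 4) ^ 3 - 1"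
      by (simp add: power2_eq_square power3_eq_cube algebra_simps)
    ultimately have "1 + B v ^ 4 + (B v ^ 4) ^ 2 = 0" using cube[OF v] by simp
    moreover have "{w. w ^ 3 = v} = {}" using False by auto
    ultimately show ?thesis by simp
  qed
qed

section \<open>The character sum over the cubic\<close>

text \<open>\<open>h_root\<close> says that h is a critical point of f(x) = (x + a)(x + b)(x + c).
  Hence f(x + h) = x^3 + d x^2 + e has no linear term, with e = f(h) and d = f''(h)/2. Putting x =
  (d/3)(s - 1) then removes the quadratic term.\<close>

lemma psi_111_eq_cubic_sum:
  fixes a b c d e h :: "'a::finite_field"
  assumes two: "2 dvd CARD('a) - 1" and three: "3 dvd CARD('a) - 1"
    and h_root: "3 * h ^ 2 + 2 * (a + b + c) * h + a * b + b * c + c * a = 0"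
    and d_def: "d = 3 * h + a + b + c"
    and e_def: "e = h ^ 3 + (a + b + c) * h ^ 2 + (a * b + b * c + c * a) * h + a * b * c"
    and d: "d \<noteq> 0"
  shows "psi_111 a b c =
    quadratic_char (3 * d) * (\<Sum>s\<in>UNIV. quadratic_char (s ^ 3 - 3 * s + (2 + 27 * e / d ^ 3)))"
proof -
  note qm = mult_char_mult[OF quadratic_char_mult_character[OF two]]
  note three0 = finite_field_three_neq_zero[OF three]
  have shift: "(x + h + a) * (x + h + b) * (x + h + c) = x ^ 3 + d * x ^ 2 + e" for x
  proof -
    have "(x + h + a) * (x + h + b) * (x + h + c) = x ^ 3 + d * x ^ 2 + e +
        x * (3 * h ^ 2 + 2 * (a + b + c) * h + a * b + b * c + c * a)"
      by (simp add: d_def e_def power2_eq_square power3_eq_cube algebra_simps)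
    then show ?thesis using h_root by simp
  qed
  define y where "y = d / 3"
  have dy: "d = 3 * y" and y0: "y \<noteq> 0" using three0 d by (simp_all add: y_def)
  define E where "E = e / y ^ 3"
  have e: "e = E * y ^ 3" using y0 by (simp add: E_def)
  have E': "27 * e / d ^ 3 = E" 
  proof -
    have "d ^ 3 \<noteq> 0" using d by simp
    moreover have "27 * e = E * d ^ 3" by (simp add: e dy power3_eq_cube)
    ultimately show ?thesis by simp
  qed
  \<comment> \<open>The leading factor y^3 is written as 3d times a square, so that the quadratic
    character sees only 3d.\<close>
  have scale: "(y * (s - 1)) ^ 3 + d * (y * (s - 1)) ^ 2 + e = 3 * d * (y / 3) ^ 2 * (s ^ 3 - 3 * s + (2 + E))" for s
  proof -
    have "3 * d * (y / 3) ^ 2 = y ^ 3"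
    proof -
      obtain w where w: "y = 3 * w" using three0 by (metis nonzero_mult_div_cancel_left times_divide_eq_right)
      then have "y / 3 = w" using three0 by simp
      then show ?thesis by (simp add: dy w power2_eq_square power3_eq_cube)
    qed
    then show ?thesis
      by (simp only: dy e) (simp add: power2_eq_square power3_eq_cube algebra_simps)
  qed
  have "psi_111 a b c = (\<Sum>x\<in>UNIV. quadratic_char ((x + a) * (x + b) * (x + c)))"
    by (simp add: psi_111_def qm)
  also have "\<dots> = (\<Sum>s\<in>UNIV. quadratic_char ((y * (s - 1) + h + a) * (y * (s - 1) + h + b) * (y * (s - 1) + h + c)))"
    by (rule sum.reindex_bij_witness[of _ "\<lambda>s. y * (s - 1) + h" "\<lambda>x. (x - h) / y + 1"]) (use y0 in auto)
  also have "\<dots> = (\<Sum>s\<in>UNIV. quadratic_char (3 * d) * quadratic_char (s ^ 3 - 3 * s + (2 + E)))"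
    unfolding shift scale using y0 three0 by (simp add: qm quadratic_char_square del: mult_numeral_left)
  finally show ?thesis by (simp add: E' sum_distrib_left)
qed

text \<open>Translation by h preserves the discriminant, and that of x^3 + d x^2 + e is -e (4 d^3 +
  27 e). It turns distinctness of a, b, c into nonvanishing of both factors.\<close>

lemma cubic_discriminant_shifted_to_critical_point:
  fixes a b c d e h :: "'a::field"
  assumes h_root: "3 * h ^ 2 + 2 * (a + b + c) * h + a * b + b * c + c * a = 0"
    and d_def: "d = 3 * h + a + b + c"
    and e_def: "e = h ^ 3 + (a + b + c) * h ^ 2 + (a * b + b * c + c * a) * h + a * b * c"
  shows "((a - b) * (b - c) * (a - c)) ^ 2 = - e * (4 * d ^ 3 + 27 * e)"
proof -
  define u v w where uvw: "u = h + a" "v = h + b" "w = h + c"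
  have s1: "d = u + v + w" by (simp add: d_def uvw)
  have s3: "e = u * v * w"
    by (simp add: e_def uvw power2_eq_square power3_eq_cube algebra_simps)
  have s2: "u * v + v * w + w * u = 0"
    using h_root by (simp add: uvw power2_eq_square algebra_simps)
  let ?p = "u * v + v * w + w * u"
  \<comment> \<open>The general discriminant in elementary symmetric functions; the second one,
    \<open>?p\<close>, is 0 at a critical point.\<close>
  have "((u - v) * (v - w) * (u - w)) ^ 2 =
      d ^ 2 * ?p ^ 2 - 4 * ?p ^ 3 - 4 * d ^ 3 * e + 18 * d * ?p * e - 27 * e ^ 2"
    unfolding s1 s3 by (simp add: power2_eq_square power3_eq_cube algebra_simps)
  then have "((u - v) * (v - w) * (u - w)) ^ 2 = - e * (4 * d ^ 3 + 27 * e)"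
    unfolding s2 by (simp add: power2_eq_square algebra_simps)
  then show ?thesis by (simp add: uvw)
qed

section \<open>Comparison of the two character sums\<close>

theorem theorem1p3:
  fixes T :: "'a::finite_field \<Rightarrow> complex" and a b c d e h :: 'a and q :: nat
  assumes q_def: "q = CARD('a)"
    and odd_char: "odd CHAR('a)"
    and q_cong: "[q = 1] (mod 6)"
    and T_char: "T \<in> carrier char_group"
    and T_gen: "generate char_group {T} = carrier char_group"
    and nonzero: "a \<noteq> 0" "b \<noteq> 0" "c \<noteq> 0"
    and distinct: "a \<noteq> b" "b \<noteq> c" "a \<noteq> c"
    and h_nonzero: "h \<noteq> 0"
    and h_root: "3 * h ^ 2 + 2 * (a + b + c) * h + a * b + b * c + c * a = 0"
    and d_def: "d = 3 * h + a + b + c"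
    and e_def: "e = h ^ 3 + (a + b + c) * h ^ 2 + (a * b + b * c + c * a) * h + a * b * c"
    and d_nonzero: "d \<noteq> 0"
  shows "psi_111 a b c =
     of_nat q * quadratic_char (-3 * d) *
     greene_2F1 (T [^]\<^bsub>char_group\<^esub> ((q - 1) div 6)) (T [^]\<^bsub>char_group\<^esub> (5 * (q - 1) div 6))
       trivial_char (- (3 ^ 3 * e / (2 ^ 2 * d ^ 3)))"
proof -
  have q1: "q \<ge> 1" by (simp add: q_def Suc_le_eq)
  have "q mod 6 = 1" using q_cong by (simp add: cong_def)
  then have "6 dvd q - 1" using q1 by presburger
  then obtain k where k: "q - 1 = 6 * k" by (metis dvdE)
  then have k': "CARD('a) - 1 = 6 * k" by (simp add: q_def)
  have two: "2 dvd CARD('a) - 1" and three: "3 dvd CARD('a) - 1" unfolding k' by simp_all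
  have two0: "(2 :: 'a) \<noteq> 0" by (rule finite_field_two_neq_zero[OF two])
  note qm = mult_char_mult[OF quadratic_char_mult_character[OF two]]
  have T: "T \<in> mult_characters" using T_char by (simp add: char_group_def)
  define B where "B = T [^]\<^bsub>char_group\<^esub> (5 * k)"
  note B = generating_char_power[OF k' T generating_char_faithful[OF T_char T_gen] B_def]
  define z where "z = - (3 ^ 3 * e / (2 ^ 2 * d ^ 3))"
  have four0: "(2 :: 'a) ^ 2 \<noteq> 0" by (rule power_not_zero[OF two0])
  have zd: "2 ^ 2 * d ^ 3 * z = - (27 * e)"
    using four0 d_nonzero by (simp add: z_def)
  \<comment> \<open>Up to nonzero factors, e and 4 d^3 + 27 e are the numerators of z and 1 -
    z.\<close>
  have disc: "e * (4 * d ^ 3 + 27 * e) \<noteq> 0"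
    using cubic_discriminant_shifted_to_critical_point[OF h_root d_def e_def] distinct by auto
  have "z \<noteq> 0"
  proof
    assume "z = 0"
    then have "3 ^ 3 * e = 0" using zd by simp
    then show False
      using power_not_zero[OF finite_field_three_neq_zero[OF three], of 3] disc by simp
  qed
  moreover have "z \<noteq> 1"
  proof
    assume "z = 1"
    then have "4 * d ^ 3 + 27 * e = 0" using zd by simp
    then show False using disc by simp
  qed
  ultimately have z: "z \<noteq> 0" "z \<noteq> 1" .
  have z4: "2 + 27 * e / d ^ 3 = 2 - 4 * z"
    using zd d_nonzero by (simp add: field_simps)
  have \<eta>: "(\<lambda>v. B v ^ 4) \<in> mult_characters"
    using B(1) by (simp add: mult_characters_def power_mult_distrib)
  have "(\<Sum>s\<in>UNIV. quadratic_char (s ^ 3 - 3 * s + (2 - 4 * z))) =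
      (\<Sum>r\<in>UNIV. quadratic_char (r + (2 - 4 * z))) +
      (\<Sum>v\<in>-{0}. B v ^ 4 * quadratic_char (v + inverse v + (2 - 4 * z)))"
    using sum_cubic_eq[OF two three \<eta> B(5) B(4), of "\<lambda>r. quadratic_char (r + (2 - 4 * z))"] by simp
  \<comment> \<open>The untwisted term of Cardano's identity is a translate of the full sum of
    \<phi> and vanishes.\<close>
  also have "(\<Sum>r\<in>UNIV. quadratic_char (r + (2 - 4 * z))) = (\<Sum>r\<in>UNIV. quadratic_char (r :: 'a))"
    by (rule sum.reindex_bij_witness[of _ "\<lambda>r. r - (2 - 4 * z)" "\<lambda>r. r + (2 - 4 * z)"]) auto
  also have "\<dots> = 0" by (rule sum_quadratic_char[OF two])
  finally have cubic: "(\<Sum>s\<in>UNIV. quadratic_char (s ^ 3 - 3 * s + (2 - 4 * z))) =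
      (\<Sum>v\<in>-{0}. B v ^ 4 * quadratic_char (v + inverse v + (2 - 4 * z)))" by simp
  have "psi_111 a b c =
      quadratic_char (3 * d) * (\<Sum>v\<in>-{0}. B v ^ 4 * quadratic_char (v + inverse v + (2 - 4 * z)))"
    using psi_111_eq_cubic_sum[OF two three h_root d_def e_def d_nonzero] by (simp only: z4 cubic)
  \<comment> \<open>The factor \<phi>(-1) is the one that accompanies Greene's series; splitting it
    off turns 3d into -3d.\<close>
  also have "quadratic_char (3 * d) = quadratic_char (- 3 * d) * quadratic_char (-1 :: 'a)"
    by (simp flip: qm)
  finally have "psi_111 a b c = quadratic_char (- 3 * d) *
      (of_nat CARD('a) * greene_2F1 (\<lambda>x. inverse (B x)) B trivial_char z)"
    using greene_2F1_order_six[OF two B(1) B(3) z] by simp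
  moreover have "(q - 1) div 6 = k" "5 * (q - 1) div 6 = 5 * k" unfolding k by simp_all
  ultimately show ?thesis
    by (simp only: B(2) q_def z_def flip: B_def) (simp add: mult_ac)
qed

end
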